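(* Let $K$ be a simplicial complex with ordered vertices containing at least one tetrahedron, let $b_{ij}\in F$ ($i<j$) be generic elements attached to the edges of $K$, put $\omega_{ijk}=b_{ij}-b_{ik}+b_{jk}$ for triangles $ijk$, $i<j<k$, and let permitted colorings be defined by the "infinitesimal" edge functionals built from $\omega$. Then the symmetric bilinear 3-cochain $z$, whose component on a tetrahedron $ijkl$ ($i<j<k<l$), as a function of two permitted colorings with components $(x_t,y_t)^{\mathrm T}$ and $(x'_t,y'_t)^{\mathrm T}$, is $$z_{ijkl}=(\omega_{jkl}-\omega_{ikl})\bigl(\omega_{ijk}\omega_{ijl}\,x_{ijkl}x'_{ijkl}-\omega_{ikl}\omega_{jkl}\,y_{ijkl}y'_{ijkl}\bigr),$$ is a nontrivial 3-cocycle; that is, it is not a coboundary, but its coboundary vanishes: for each pentachoron $u\subset K$ and any two permitted colorings of $u$, $$\sum_{t\subset u}\epsilon_t^{(u)} z_t=0,$$ the sum being over the five tetrahedra $t\subset u$.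
   Context: A pentachoron is a 4-simplex and a tetrahedron is a 3-simplex; simplices are written with vertices in increasing order. $F$ is a field (any characteristic), big enough to contain generic elements; "generic" means that, on each simplex, the $b_{ij}$ lie outside the zero set of some suitable nonzero polynomial (they satisfy no accidental algebraic relation). A coloring assigns to each tetrahedron $t$ a column $(x_t,y_t)^{\mathrm T}\in F^2$. Orient each pentachoron $u$ by the increasing order of its vertices. For a tetrahedron $t\subset u$, $\epsilon_t^{(u)}=+1$ if the orientation of $t$ given by the increasing order of its vertices coincides with that induced from $u$, and $-1$ otherwise (so that, up to an overall sign per pentachoron, $\epsilon_t^{(u)}=(-1)^m$ if $t$ is obtained from $u=i_0\dots i_4$ by omitting $i_m$). Infinitesimal edge functionals: for a tetrahedron $t=1234$ set $$r(12)=(\omega_{234}-\omega_{134},\,0),\quad r(13)=(\omega_{124},\,\omega_{234}),\quad r(14)=(-\omega_{123},\,-\omega_{234}),$$ $$r(23)=(-\omega_{124},\,-\omega_{134}),\quad r(24)=(\omega_{123},\,\omega_{134}),\quad r(34)=(0,\,\omega_{123}-\omega_{124}),$$ and for $t=ijkl$, $i<j<k<l$, define the rows $r_t(e)$ ($e$ an edge of $t$) by substituting $1\mapsto i$, $2\mapsto j$, $3\mapsto k$, $4\mapsto l$. For an edge $e\subset u$, the edge functional is $\phi^{(u)}_{e}=\sum_{t:\ e\subset t\subset u}\epsilon^{(u)}_t\,r_t(e)\,(x_t,y_t)^{\mathrm T}$. A coloring of a pentachoron $u$ is permitted if $\phi_e^{(u)}=0$ for all ten edges $e\subset u$. All colorings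 of a tetrahedron are permitted; a coloring of a simplex of dimension $>4$ is permitted if its restrictions to all 4-faces are permitted. Cohomology: for $n\ge3$, a symmetric bilinear $n$-cochain $\mathfrak c$ assigns to each $n$-simplex $i_0\dots i_n$ of $K$ a symmetric bilinear form $\mathfrak c_{i_0\dots i_n}$ with values in $F$ on the vector space of permitted colorings of that simplex. The coboundary is $(\delta\mathfrak c)_{i_0\dots i_{n+1}}=\sum_{m=0}^{n+1}(-1)^m\mathfrak c_{i_0\dots\widehat{i_m}\dots i_{n+1}}$, where each term is evaluated on the restrictions of the permitted colorings to the corresponding face. The cochain complex is $0\to C^3\to C^4\to C^5\to\cdots$ (there are no 2-cochains, so the only 3-coboundary is zero). *)

theory Defs
  imports
    "HOL-Analysis.Finite_Cartesian_Product"
    "HOL-Analysis.Cartesian_Space"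
    "HOL-Library.Poly_Mapping"
begin

definition ordered_complex :: "'v::linorder set set \<Rightarrow> bool" where
  "ordered_complex K \<longleftrightarrow>
     (\<forall>s\<in>K. finite s \<and> s \<noteq> {}) \<and> (\<forall>s\<in>K. \<forall>t. t \<subseteq> s \<and> t \<noteq> {} \<longrightarrow> t \<in> K)"

definition simplices :: "'v set set \<Rightarrow> nat \<Rightarrow> 'v set set" where
  "simplices K n = {s \<in> K. card s = n + 1}"

definition faces :: "nat \<Rightarrow> 'v set \<Rightarrow> 'v set set" where
  "faces k s = {t. t \<subseteq> s \<and> card t = k + 1}"

text \<open>The vertices of a simplex in increasing order are \<open>vert s 0 < vert s 1 < \<dots>\<close>.\<close>

definition vert :: "'v::linorder set \<Rightarrow> nat \<Rightarrow> 'v" where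
  "vert s m = sorted_list_of_set s ! m"

definition omit :: "'v::linorder set \<Rightarrow> nat \<Rightarrow> 'v set" where
  "omit s m = s - {vert s m}"


text \<open>
  A polynomial is a finitely supported map from monomials to coefficients, a monomial being a
  finitely supported map from variables to exponents. For an \<open>n\<close>-simplex with vertices
  \<open>v\<^sub>0 < \<dots> < v\<^sub>n\<close>, the variable \<open>(i, j)\<close> with \<open>i < j \<le> n\<close> stands for
  \<open>b v\<^sub>i v\<^sub>j\<close>.
\<close>

type_synonym ('x, 'a) mpoly = "('x \<Rightarrow>\<^sub>0 nat) \<Rightarrow>\<^sub>0 'a"

definition mpoly_eval :: "('x \<Rightarrow> 'a) \<Rightarrow> ('x, 'a::comm_semiring_1) mpoly \<Rightarrow> 'a" where
  "mpoly_eval \<beta> P =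
     (\<Sum>m\<in>Poly_Mapping.keys P. Poly_Mapping.lookup P m *
        (\<Prod>x\<in>Poly_Mapping.keys m. \<beta> x ^ Poly_Mapping.lookup m x))"

definition edge_poly :: "nat \<Rightarrow> (nat \<times> nat, 'a::zero) mpoly \<Rightarrow> bool" where
  "edge_poly n P \<longleftrightarrow>
     (\<forall>m\<in>Poly_Mapping.keys P. Poly_Mapping.keys m \<subseteq> {(i, j). i < j \<and> j \<le> n})"

text \<open>
  Genericity of \<open>b\<close> relative to a choice of one polynomial per dimension. Statements about generic
  \<open>b\<close> have the form: there are nonzero \<open>P n\<close>, chosen before \<open>K\<close> and \<open>b\<close>, such that the claim holds
  whenever \<open>b\<close> is generic for \<open>P\<close>. A finite field may be too small to contain generic \<open>b\<close> for a given
  \<open>P\<close>; such a statement over an infinite field \<open>'a\<close> covers, with one and the same \<open>P\<close>, all \<open>b\<close> with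
  values in finite subfields of \<open>'a\<close>.
\<close>

definition generic ::
  "(nat \<Rightarrow> (nat \<times> nat, 'a::field) mpoly) \<Rightarrow> 'v::linorder set set \<Rightarrow> ('v \<Rightarrow> 'v \<Rightarrow> 'a) \<Rightarrow> bool" where
  "generic P K b \<longleftrightarrow>
     (\<forall>n. \<forall>s\<in>simplices K n. mpoly_eval (\<lambda>(i, j). b (vert s i) (vert s j)) (P n) \<noteq> 0)"


text \<open>\<open>b i j\<close> is attached to the edge \<open>ij\<close>, and is only ever used for \<open>i < j\<close>.\<close>

definition omega :: "('v \<Rightarrow> 'v \<Rightarrow> 'a::field) \<Rightarrow> 'v \<Rightarrow> 'v \<Rightarrow> 'v \<Rightarrow> 'a" where
  "omega b i j k = b i j - b i k + b j k"

text \<open>The row \<open>r\<^sub>t(e)\<close>; it is used only for edges \<open>e\<close> of the tetrahedron \<open>t\<close>.\<close>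

definition edge_row :: "('v::linorder \<Rightarrow> 'v \<Rightarrow> 'a::field) \<Rightarrow> 'v set \<Rightarrow> 'v set \<Rightarrow> 'a^2" where
  "edge_row b t e =
     (let i = vert t 0; j = vert t 1; k = vert t 2; l = vert t 3; \<omega> = omega b in
      if e = {i, j} then vector [\<omega> j k l - \<omega> i k l, 0]
      else if e = {i, k} then vector [\<omega> i j l, \<omega> j k l]
      else if e = {i, l} then vector [- \<omega> i j k, - \<omega> j k l]
      else if e = {j, k} then vector [- \<omega> i j l, - \<omega> i k l]
      else if e = {j, l} then vector [\<omega> i j k, \<omega> i k l]
      else if e = {k, l} then vector [0, \<omega> i j k - \<omega> i j l]
      else 0)"

text \<open>
  \<open>t\<close> is obtained from \<open>u\<close> by omitting a single vertex; the exponent is the position of that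
  vertex in \<open>u\<close>, so that \<open>eps u (omit u m) = (-1)^m\<close>.
\<close>

definition eps :: "'v::linorder set \<Rightarrow> 'v set \<Rightarrow> 'a::field" where
  "eps u t = (- 1) ^ card {v \<in> u. \<exists>w \<in> u - t. v < w}"

text \<open>
  A coloring of a simplex \<open>s\<close> is a map on its tetrahedra, extended by zero to all other sets.
  The components of \<open>c t\<close> are \<open>x\<^sub>t = c t $ 1\<close> and \<open>y\<^sub>t = c t $ 2\<close>.
\<close>

type_synonym ('v, 'a) coloring = "'v set \<Rightarrow> 'a^2"

definition colorings :: "'v set \<Rightarrow> ('v, 'a::field) coloring set" where
  "colorings s = {c. \<forall>t. t \<notin> faces 3 s \<longrightarrow> c t = 0}"

definition restr :: "('v, 'a::field) coloring \<Rightarrow> 'v set \<Rightarrow> ('v, 'a) coloring" where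
  "restr c s = (\<lambda>t. if t \<in> faces 3 s then c t else 0)"

definition edge_functional ::
  "('v::linorder \<Rightarrow> 'v \<Rightarrow> 'a::field) \<Rightarrow> 'v set \<Rightarrow> 'v set \<Rightarrow> ('v, 'a) coloring \<Rightarrow> 'a" where
  "edge_functional b u e c =
     (\<Sum>t \<in> {t \<in> faces 3 u. e \<subseteq> t}. eps u t * (edge_row b t e $ 1 * c t $ 1 + edge_row b t e $ 2 * c t $ 2))"

text \<open>A tetrahedron has no 4-faces, so all its colorings are permitted.\<close>

definition permitted ::
  "('v::linorder \<Rightarrow> 'v \<Rightarrow> 'a::field) \<Rightarrow> 'v set \<Rightarrow> ('v, 'a) coloring set" where
  "permitted b s =
     {c \<in> colorings s. \<forall>u\<in>faces 4 s. \<forall>e\<in>faces 1 u. edge_functional b u e (restr c u) = 0}"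


definition sym_bilinear_on ::
  "('v, 'a::field) coloring set \<Rightarrow> (('v, 'a) coloring \<Rightarrow> ('v, 'a) coloring \<Rightarrow> 'a) \<Rightarrow> bool" where
  "sym_bilinear_on V B \<longleftrightarrow>
     (\<forall>f\<in>V. \<forall>g\<in>V. B f g = B g f) \<and>
     (\<forall>f\<in>V. \<forall>g\<in>V. \<forall>h\<in>V. B (\<lambda>t. f t + g t) h = B f h + B g h) \<and>
     (\<forall>a. \<forall>f\<in>V. \<forall>g\<in>V. B (\<lambda>t. a *s f t) g = a * B f g)"

type_synonym ('v, 'a) cochain =
  "'v set \<Rightarrow> ('v, 'a) coloring \<Rightarrow> ('v, 'a) coloring \<Rightarrow> 'a"

text \<open>
  The complex starts in degree 3: for \<open>n < 3\<close> only the zero cochain is admitted. Values outside the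
  \<open>n\<close>-simplices of \<open>K\<close> and their permitted colorings are irrelevant, so cochains are compared with
  \<open>cochain_eq\<close>.
\<close>

definition is_cochain ::
  "'v::linorder set set \<Rightarrow> ('v \<Rightarrow> 'v \<Rightarrow> 'a::field) \<Rightarrow> nat \<Rightarrow> ('v, 'a) cochain \<Rightarrow> bool" where
  "is_cochain K b n c \<longleftrightarrow>
     (if n < 3 then c = (\<lambda>s f g. 0)
      else \<forall>s\<in>simplices K n. sym_bilinear_on (permitted b s) (c s))"

definition cochain_eq ::
  "'v::linorder set set \<Rightarrow> ('v \<Rightarrow> 'v \<Rightarrow> 'a::field) \<Rightarrow> nat \<Rightarrow> ('v, 'a) cochain \<Rightarrow> ('v, 'a) cochain \<Rightarrow> bool"
  where
  "cochain_eq K b n c d \<longleftrightarrow>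
     (\<forall>s\<in>simplices K n. \<forall>f\<in>permitted b s. \<forall>g\<in>permitted b s. c s f g = d s f g)"

definition coboundary :: "('v::linorder, 'a::field) cochain \<Rightarrow> ('v, 'a) cochain" where
  "coboundary c = (\<lambda>s f g.
     \<Sum>m<card s. (- 1) ^ m * c (omit s m) (restr f (omit s m)) (restr g (omit s m)))"

definition is_cocycle ::
  "'v::linorder set set \<Rightarrow> ('v \<Rightarrow> 'v \<Rightarrow> 'a::field) \<Rightarrow> nat \<Rightarrow> ('v, 'a) cochain \<Rightarrow> bool" where
  "is_cocycle K b n c \<longleftrightarrow>
     is_cochain K b n c \<and> cochain_eq K b (n + 1) (coboundary c) (\<lambda>s f g. 0)"

definition is_coboundary ::
  "'v::linorder set set \<Rightarrow> ('v \<Rightarrow> 'v \<Rightarrow> 'a::field) \<Rightarrow> nat \<Rightarrow> ('v, 'a) cochain \<Rightarrow> bool" where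
  "is_coboundary K b n c \<longleftrightarrow>
     (\<exists>d. is_cochain K b (n - 1) d \<and> cochain_eq K b n c (coboundary d))"


definition z_cochain :: "('v::linorder \<Rightarrow> 'v \<Rightarrow> 'a::field) \<Rightarrow> ('v, 'a) cochain" where
  "z_cochain b t f g =
     (let i = vert t 0; j = vert t 1; k = vert t 2; l = vert t 3; \<omega> = omega b in
      (\<omega> j k l - \<omega> i k l) *
      (\<omega> i j k * \<omega> i j l * (f t $ 1 * g t $ 1) - \<omega> i k l * \<omega> j k l * (f t $ 2 * g t $ 2)))"

end

theory Submission
  imports Defs
begin

text \<open>
  Let \<open>t = 1234\<close> be a tetrahedron and \<open>(x, y)\<close> its color. The six numbers \<open>r\<^sub>t(e) (x, y)\<close> turn out to
  be differences of a single function \<open>p\<close> on the four triangles of \<open>t\<close>: up to sign,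
  \<open>r\<^sub>t(e) (x, y)\<close> is the difference of the values of \<open>p\<close> on the two triangles of \<open>t\<close> that share the
  edge \<open>e\<close>. Such a \<open>p\<close>, unique up to an additive constant, is called a \<open>potential\<close> of the color.
  It satisfies \<open>\<omega>\<^sub>2\<^sub>3\<^sub>4 p\<^sub>2\<^sub>3\<^sub>4 - \<omega>\<^sub>1\<^sub>3\<^sub>4 p\<^sub>1\<^sub>3\<^sub>4 + \<omega>\<^sub>1\<^sub>2\<^sub>4 p\<^sub>1\<^sub>2\<^sub>4 - \<omega>\<^sub>1\<^sub>2\<^sub>3 p\<^sub>1\<^sub>2\<^sub>3 = 0\<close>, a relation that
  survives adding a constant to \<open>p\<close> because \<open>\<omega>\<close> is a cocycle (\<open>omega_cocycle\<close>).

  Two facts then make \<open>z\<close> a cocycle. The first is that a permitted coloring of a pentachoron has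
  one potential on all ten triangles, restricting to a potential on each of the five tetrahedra
  (\<open>permitted_potential\<close>). Indeed, the tetrahedra around an edge \<open>e\<close> form a cycle, consecutive
  ones sharing a triangle that contains \<open>e\<close>, and the equation \<open>\<phi>\<^sub>e = 0\<close> says that the differences
  of the local potentials add up to zero along this cycle. So a closed system of differences is given on
  the cell structure dual to the boundary of the pentachoron; this is a 3-sphere, hence simply
  connected, and the differences integrate.

  The second fact is that, in terms of potentials \<open>p\<close> and \<open>q\<close> of two colors of \<open>t\<close>, the form \<open>z\<^sub>t\<close>
  is the alternating sum of \<open>\<omega>\<^sub>\<tau> p\<^sub>\<tau> q\<^sub>\<tau>\<close> over the triangles \<open>\<tau>\<close> of \<open>t\<close> (\<open>z_cochain_eq_boundary\<close>).
  With potentials shared by the whole pentachoron, the alternating sum of the \<open>z\<^sub>t\<close> vanishes since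
  each triangle lies in two tetrahedra, with opposite signs.

  Nontriviality is a matter of \<open>z\<close> being nonzero, as the only 3-coboundary is zero. On a single
  tetrahedron the color \<open>(1, 0)\<close> is permitted and gives \<open>z = (\<omega>\<^sub>2\<^sub>3\<^sub>4 - \<omega>\<^sub>1\<^sub>3\<^sub>4) \<omega>\<^sub>1\<^sub>2\<^sub>3 \<omega>\<^sub>1\<^sub>2\<^sub>4\<close>. Its three
  factors are linear forms in \<open>b\<close> that belong to a tetrahedron and to two triangles; these forms
  are the polynomials that define genericity here.
\<close>

section \<open>Simplices and their facets in coordinates\<close>

lemma vert_set:
  assumes "sorted_wrt (<) xs" "m < length xs"
  shows "vert (set xs) m = xs ! m"
  using assms by (simp add: vert_def sorted_list_of_set.idem_if_sorted_distinct strict_sorted_iff)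

lemma vert_tetrahedron:
  assumes "i < j" "j < k" "k < l"
  shows "vert {i, j, k, l} 0 = i" "vert {i, j, k, l} 1 = j"
    "vert {i, j, k, l} 2 = k" "vert {i, j, k, l} 3 = l"
proof -
  have "sorted_wrt (<) [i, j, k, l]" using assms by auto
  note vert = vert_set[OF this]
  show "vert {i, j, k, l} 0 = i" "vert {i, j, k, l} 1 = j" "vert {i, j, k, l} 2 = k" "vert {i, j, k, l} 3 = l"
    using vert[of 0] vert[of 1] vert[of 2] vert[of 3] by simp_all
qed

lemma vert_triangle:
  assumes "i < j" "j < k"
  shows "vert {i, j, k} 0 = i" "vert {i, j, k} 1 = j" "vert {i, j, k} 2 = k"
proof -
  have "sorted_wrt (<) [i, j, k]" using assms by auto
  note vert = vert_set[OF this]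
  show "vert {i, j, k} 0 = i" "vert {i, j, k} 1 = j" "vert {i, j, k} 2 = k"
    using vert[of 0] vert[of 1] vert[of 2] by simp_all
qed

lemma vert_pentachoron:
  assumes "i < j" "j < k" "k < l" "l < h"
  shows "vert {i, j, k, l, h} 0 = i" "vert {i, j, k, l, h} 1 = j"
    "vert {i, j, k, l, h} 2 = k" "vert {i, j, k, l, h} 3 = l" "vert {i, j, k, l, h} 4 = h"
proof -
  have "sorted_wrt (<) [i, j, k, l, h]" using assms by auto
  note vert = vert_set[OF this]
  show "vert {i, j, k, l, h} 0 = i" "vert {i, j, k, l, h} 1 = j" "vert {i, j, k, l, h} 2 = k" "vert {i, j, k, l, h} 3 = l" "vert {i, j, k, l, h} 4 = h"
    using vert[of 0] vert[of 1] vert[of 2] vert[of 3] vert[of 4] by simp_all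
qed

lemma bij_betw_vert:
  assumes "finite s"
  shows "bij_betw (vert s) {..<card s} s"
  using bij_betw_nth[of "sorted_list_of_set s" "{..<card s}" s] assms
  by (simp add: vert_def [abs_def] atLeast0LessThan)

lemma vert_less_iff:
  assumes "m < card s" "n < card s"
  shows "vert s m < vert s n \<longleftrightarrow> m < n"
proof -
  have "sorted_wrt (<) (sorted_list_of_set s)"
    by (simp add: strict_sorted_list_of_set)
  then have "i < j \<Longrightarrow> j < card s \<Longrightarrow> vert s i < vert s j" for i j
    by (simp add: vert_def sorted_wrt_iff_nth_less)
  then show ?thesis
    using assms by (metis less_asym linorder_neqE_nat)
qed

lemma pentachoron_cases:
  fixes u :: "'v::linorder set"
  assumes "card u = 5"
  obtains i j k l h where "i < j" "j < k" "k < l" "l < h" "u = {i, j, k, l, h}"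
proof -
  let ?xs = "sorted_list_of_set u"
  have "finite u" using assms by (simp add: card_ge_0_finite)
  then have u: "u = set ?xs" by simp
  have "\<exists>i j k l h. xs = [i, j, k, l, h]" if "length xs = 5" for xs :: "'v list"
    using that by (auto simp: eval_nat_numeral length_Suc_conv)
  moreover have "length ?xs = 5" using assms by simp
  ultimately obtain i j k l h where xs: "?xs = [i, j, k, l, h]"
    by blast
  have "sorted_wrt (<) ?xs" by (rule strict_sorted_list_of_set)
  with xs have "i < j" "j < k" "k < l" "l < h" by auto
  with u xs show ?thesis by (intro that) auto
qed

lemma tetrahedron_cases:
  fixes t :: "'v::linorder set"
  assumes "card t = 4"
  obtains i j k l where "i < j" "j < k" "k < l" "t = {i, j, k, l}"
proof -
  let ?xs = "sorted_list_of_set t"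
  have "finite t" using assms by (simp add: card_ge_0_finite)
  then have t: "t = set ?xs" by simp
  have "\<exists>i j k l. xs = [i, j, k, l]" if "length xs = 4" for xs :: "'v list"
    using that by (auto simp: eval_nat_numeral length_Suc_conv)
  moreover have "length ?xs = 4" using assms by simp
  ultimately obtain i j k l where xs: "?xs = [i, j, k, l]"
    by blast
  have "sorted_wrt (<) ?xs" by (rule strict_sorted_list_of_set)
  with xs have "i < j" "j < k" "k < l" by auto
  with t xs show ?thesis by (intro that) auto
qed

lemma omit_pentachoron:
  assumes "i < j" "j < k" "k < l" "l < h"
  shows "omit {i, j, k, l, h} 0 = {j, k, l, h}" "omit {i, j, k, l, h} 1 = {i, k, l, h}"
    "omit {i, j, k, l, h} 2 = {i, j, l, h}" "omit {i, j, k, l, h} 3 = {i, j, k, h}"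
    "omit {i, j, k, l, h} 4 = {i, j, k, l}"
  unfolding omit_def vert_pentachoron[OF assms] using assms by auto

lemma bij_betw_omit:
  assumes "card u = k + 2"
  shows "bij_betw (omit u) {..<card u} (faces k u)"
proof (rule bij_betw_imageI)
  have fin: "finite u" using assms by (simp add: card_ge_0_finite)
  have bij: "bij_betw (vert u) {..<card u} u" by (rule bij_betw_vert[OF fin])
  have v: "vert u m \<in> u" if "m < card u" for m
    using bij that by (auto simp: bij_betw_def)
  show "inj_on (omit u) {..<card u}"
  proof (rule inj_onI)
    fix m n assume mn: "m \<in> {..<card u}" "n \<in> {..<card u}" "omit u m = omit u n"
    then have "vert u m = vert u n" using v[of m] v[of n] by (auto simp: omit_def)
    then show "m = n" using bij mn by (auto simp: bij_betw_def dest: inj_onD)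
  qed
  show "omit u ` {..<card u} = faces k u"
  proof
    show "omit u ` {..<card u} \<subseteq> faces k u"
      using v fin assms by (auto simp: omit_def faces_def)
    show "faces k u \<subseteq> omit u ` {..<card u}"
    proof
      fix t assume "t \<in> faces k u"
      then have t: "t \<subseteq> u" "card t = k + 1" by (auto simp: faces_def)
      then have "card (u - t) = 1" using fin assms by (simp add: card_Diff_subset finite_subset)
      then obtain w where w: "u - t = {w}" by (auto simp: card_1_singleton_iff)
      then have "w \<in> u" by auto
      then obtain m where "m < card u" "w = vert u m" using bij by (auto simp: bij_betw_def)
      moreover have "t = u - {w}" using w t by auto
      ultimately show "t \<in> omit u ` {..<card u}" by (auto simp: omit_def)
    qed
  qed
qed

lemma eps_omit:
  assumes "m < card u"
  shows "eps u (omit u m) = (- 1) ^ m"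
proof -
  have fin: "finite u" using assms by (simp add: card_ge_0_finite)
  have bij: "bij_betw (vert u) {..<card u} u" by (rule bij_betw_vert[OF fin])
  then have "vert u m \<in> u" using assms by (auto simp: bij_betw_def)
  then have "{v \<in> u. \<exists>w \<in> u - omit u m. v < w} = {v \<in> u. v < vert u m}"
    by (auto simp: omit_def)
  also have "\<dots> = vert u ` {n \<in> {..<card u}. vert u n < vert u m}"
    using bij by (auto simp: bij_betw_def)
  also have "{n \<in> {..<card u}. vert u n < vert u m} = {..<m}"
    using assms vert_less_iff by fastforce
  finally have "{v \<in> u. \<exists>w \<in> u - omit u m. v < w} = vert u ` {..<m}" .
  moreover have "inj_on (vert u) {..<m}"
    using bij assms by (auto simp: bij_betw_def intro: inj_on_subset)
  ultimately show ?thesis by (simp add: eps_def card_image)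
qed

text \<open>
  This translates between the two descriptions of a signed sum over facets: by orientations, as in
  the edge functionals, and by the position of the omitted vertex, as in the coboundary.
\<close>

lemma sum_eps_faces:
  assumes "card u = k + 2"
  shows "(\<Sum>t\<in>faces k u. eps u t * F t) = (\<Sum>m<card u. (- 1) ^ m * F (omit u m))"
  using sum.reindex_bij_betw[OF bij_betw_omit[OF assms], of "\<lambda>t. eps u t * F t"]
  by (simp add: eps_omit)

lemma faces_self: "finite s \<Longrightarrow> card s = k + 1 \<Longrightarrow> faces k s = {s}"
  unfolding faces_def using card_subset_eq[of s] by auto

section \<open>Edge functionals and potentials\<close>

text \<open>
  The sum in an edge functional may therefore run over all five tetrahedra of the pentachoron.
\<close>

lemma edge_row_outside:
  assumes "card t = 4" "\<not> e \<subseteq> t"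
  shows "edge_row b t e = 0"
proof -
  obtain i j k l where "i < j" "j < k" "k < l" "t = {i, j, k, l}"
    using tetrahedron_cases[OF assms(1)] .
  moreover from this assms(2)
  have "e \<noteq> {i, j}" "e \<noteq> {i, k}" "e \<noteq> {i, l}" "e \<noteq> {j, k}" "e \<noteq> {j, l}" "e \<noteq> {k, l}"
    by blast+
  ultimately show ?thesis
    by (simp add: edge_row_def vert_tetrahedron Let_def del: One_nat_def)
qed

lemma edge_functional_alt:
  assumes "card u = 5"
  shows "edge_functional b u e c =
    (\<Sum>m<5. (- 1) ^ m * (edge_row b (omit u m) e $ 1 * c (omit u m) $ 1
                        + edge_row b (omit u m) e $ 2 * c (omit u m) $ 2))"
proof -
  have fin: "finite (faces 3 u)"
    using assms by (auto simp: faces_def card_ge_0_finite)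
  have "edge_functional b u e c =
      (\<Sum>t\<in>faces 3 u. eps u t * (edge_row b t e $ 1 * c t $ 1 + edge_row b t e $ 2 * c t $ 2))"
    unfolding edge_functional_def
    by (rule sum.mono_neutral_left) (use fin in \<open>auto simp: edge_row_outside faces_def\<close>)
  then show ?thesis
    using assms by (simp add: sum_eps_faces)
qed

lemma restr_face: "t \<in> faces 3 s \<Longrightarrow> restr c s t = c t"
  by (simp add: restr_def)

text \<open>
  The three differences belong to the edges 12, 34 and 13 of \<open>t = 1234\<close>; they determine \<open>p\<close> on
  the triangles of \<open>t\<close> up to a constant. A value \<open>p i j k\<close> is read only for \<open>i < j < k\<close>.
\<close>

definition potential ::
  "('v::linorder \<Rightarrow> 'v \<Rightarrow> 'a::field) \<Rightarrow> 'v set \<Rightarrow> 'a^2 \<Rightarrow> ('v \<Rightarrow> 'v \<Rightarrow> 'v \<Rightarrow> 'a) \<Rightarrow> bool" where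
  "potential b t c p \<longleftrightarrow>
     (let i = vert t 0; j = vert t 1; k = vert t 2; l = vert t 3; \<omega> = omega b in
      p i j l - p i j k = (\<omega> j k l - \<omega> i k l) * c $ 1 \<and>
      p j k l - p i k l = (\<omega> j k l - \<omega> i k l) * c $ 2 \<and>
      p i j k - p i k l = \<omega> i j l * c $ 1 + \<omega> j k l * c $ 2)"

lemma omega_cocycle: "omega b j k l - omega b i k l + omega b i j l - omega b i j k = 0"
  by (simp add: omega_def)

text \<open>
  Write \<open>A, B, C, D\<close> for the values of \<open>\<omega>\<close> on 123, 124, 134, 234, and \<open>P, Q\<close> for the values of the two
  potentials on 134. The right-hand side is then a polynomial in \<open>P, Q\<close> and the colors. Its \<open>P Q\<close>
  coefficient is the alternating sum \<open>D - C + B - A = 0\<close>, and the terms linear in \<open>P\<close> or \<open>Q\<close> carry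
  the alternating sum of \<open>\<omega> p\<close> with \<open>p\<close> normalised to 0 on 134, which is also 0. What remains is
  a form in the colors alone, whose mixed terms cancel as well.
\<close>

lemma z_cochain_eq_boundary:
  fixes b :: "'v::linorder \<Rightarrow> 'v \<Rightarrow> 'a::field"
  assumes "potential b t (f t) p" "potential b t (g t) q"
  defines "W \<equiv> \<lambda>i j k. omega b i j k * p i j k * q i j k"
  shows "z_cochain b t f g =
    W (vert t 1) (vert t 2) (vert t 3) - W (vert t 0) (vert t 2) (vert t 3)
    + W (vert t 0) (vert t 1) (vert t 3) - W (vert t 0) (vert t 1) (vert t 2)"
proof -
  define i j k l where "i = vert t 0" and "j = vert t 1" and "k = vert t 2" and "l = vert t 3"
  note ijkl = i_def[symmetric] j_def[symmetric] k_def[symmetric] l_def[symmetric]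
  have key: "(D - C) * (A * B * (x * x') - C * D * (y * y')) =
      D * (P + (D - C) * y) * (Q + (D - C) * y') - C * P * Q
      + B * (P + A * x + D * y) * (Q + A * x' + D * y')
      - A * (P + B * x + D * y) * (Q + B * x' + D * y')"
    if "D - C + B - A = 0" for A B C D P Q x x' y y' :: 'a
  proof -
    have "A = D - C + B" using that by (simp add: algebra_simps)
    then show ?thesis by (simp only:) (simp add: algebra_simps)
  qed
  have p: "p j k l = p i k l + (omega b j k l - omega b i k l) * f t $ 2"
    "p i j k = p i k l + omega b i j l * f t $ 1 + omega b j k l * f t $ 2"
    "p i j l = p i k l + omega b i j k * f t $ 1 + omega b j k l * f t $ 2"
    using assms(1) omega_cocycle[of b j k l i] unfolding potential_def Let_def ijkl
    by algebra+
  have q: "q j k l = q i k l + (omega b j k l - omega b i k l) * g t $ 2"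
    "q i j k = q i k l + omega b i j l * g t $ 1 + omega b j k l * g t $ 2"
    "q i j l = q i k l + omega b i j k * g t $ 1 + omega b j k l * g t $ 2"
    using assms(2) omega_cocycle[of b j k l i] unfolding potential_def Let_def ijkl
    by algebra+
  show ?thesis
    unfolding z_cochain_def Let_def W_def ijkl p q
    by (rule key[OF omega_cocycle])
qed

lemma edge_row_tetrahedron:
  assumes "i < j" "j < k" "k < l"
  shows "edge_row b {i, j, k, l} {i, j} = vector [omega b j k l - omega b i k l, 0]"
    "edge_row b {i, j, k, l} {i, k} = vector [omega b i j l, omega b j k l]"
    "edge_row b {i, j, k, l} {i, l} = vector [- omega b i j k, - omega b j k l]"
    "edge_row b {i, j, k, l} {j, k} = vector [- omega b i j l, - omega b i k l]"
    "edge_row b {i, j, k, l} {j, l} = vector [omega b i j k, omega b i k l]"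
    "edge_row b {i, j, k, l} {k, l} = vector [0, omega b i j k - omega b i j l]"
proof -
  have "i \<noteq> j" "i \<noteq> k" "i \<noteq> l" "j \<noteq> k" "j \<noteq> l" "k \<noteq> l"
    using assms by auto
  note neq = this this[symmetric]
  show "edge_row b {i, j, k, l} {i, j} = vector [omega b j k l - omega b i k l, 0]"
    "edge_row b {i, j, k, l} {i, k} = vector [omega b i j l, omega b j k l]"
    "edge_row b {i, j, k, l} {i, l} = vector [- omega b i j k, - omega b j k l]"
    "edge_row b {i, j, k, l} {j, k} = vector [- omega b i j l, - omega b i k l]"
    "edge_row b {i, j, k, l} {j, l} = vector [omega b i j k, omega b i k l]"
    "edge_row b {i, j, k, l} {k, l} = vector [0, omega b i j k - omega b i j l]"
    unfolding edge_row_def Let_def vert_tetrahedron[OF assms] by (simp_all add: doubleton_eq_iff neq)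
qed

lemma permitted_edge_equation:
  assumes "card u = 5" "c \<in> permitted b u" "e \<subseteq> u" "card e = 2"
  shows "(\<Sum>m<5. (- 1) ^ m * (edge_row b (omit u m) e $ 1 * c (omit u m) $ 1
                        + edge_row b (omit u m) e $ 2 * c (omit u m) $ 2)) = 0"
proof -
  have "finite u" using assms(1) by (simp add: card_ge_0_finite)
  then have "edge_functional b u e (restr c u) = 0"
    using assms by (simp add: permitted_def faces_self) (simp add: faces_def)
  moreover have "omit u m \<in> faces 3 u" if "m < 5" for m
    using bij_betw_omit[of u 3] assms(1) that by (auto simp: bij_betw_def)
  ultimately show ?thesis
    using assms(1) by (simp add: edge_functional_alt restr_face)
qed

text \<open>
  Integration of the closed system of differences. Starting from the value 0 on the first triangle,
  the potential is extended over the tetrahedra \<open>ijkl\<close>, \<open>ijkh\<close>, \<open>ijlh\<close>, \<open>iklh\<close> in turn. By then all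
  ten triangles have a value, and six of the fifteen differences have not been used in assigning
  them: one in \<open>ijlh\<close>, two in \<open>iklh\<close> and three in \<open>jklh\<close>. Each of these holds by the equation
  \<open>\<phi>\<^sub>e = 0\<close> for the edge \<open>e\<close> shared by the two triangles that are compared.
\<close>

lemma permitted_potential:
  fixes b :: "'v::linorder \<Rightarrow> 'v \<Rightarrow> 'a::field"
  assumes u: "card u = 5" and c: "c \<in> permitted b u"
  shows "\<exists>p. \<forall>m<5. potential b (omit u m) (c (omit u m)) p"
proof -
  obtain i j k l h where ord: "i < j" "j < k" "k < l" "l < h" and u_eq: "u = {i, j, k, l, h}"
    using pentachoron_cases[OF u] .
  have trans: "i < k" "i < l" "i < h" "j < l" "j < h" "k < h"
    using ord by auto
  have neq: "i \<noteq> j" "i \<noteq> k" "i \<noteq> l" "i \<noteq> h" "j \<noteq> k" "j \<noteq> l" "j \<noteq> h" "k \<noteq> l" "k \<noteq> h" "l \<noteq> h"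
    using ord trans by auto
  define \<omega> where "\<omega> = omega b"
  define x0 y0 where "x0 = c {j, k, l, h} $ 1" and "y0 = c {j, k, l, h} $ 2"
  define x1 y1 where "x1 = c {i, k, l, h} $ 1" and "y1 = c {i, k, l, h} $ 2"
  define x2 y2 where "x2 = c {i, j, l, h} $ 1" and "y2 = c {i, j, l, h} $ 2"
  define x3 y3 where "x3 = c {i, j, k, h} $ 1" and "y3 = c {i, j, k, h} $ 2"
  define x4 y4 where "x4 = c {i, j, k, l} $ 1" and "y4 = c {i, j, k, l} $ 2"
  note xy = x0_def y0_def x1_def y1_def x2_def y2_def x3_def y3_def x4_def y4_def
  have sum5: "(\<Sum>m<5. F m) = F 0 + F 1 + F 2 + F 3 + F (4::nat)" for F :: "nat \<Rightarrow> 'a"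
    by (simp add: eval_nat_numeral add.assoc)
  have eq: "edge_row b {j, k, l, h} e $ 1 * x0 + edge_row b {j, k, l, h} e $ 2 * y0
      - (edge_row b {i, k, l, h} e $ 1 * x1 + edge_row b {i, k, l, h} e $ 2 * y1)
      + (edge_row b {i, j, l, h} e $ 1 * x2 + edge_row b {i, j, l, h} e $ 2 * y2)
      - (edge_row b {i, j, k, h} e $ 1 * x3 + edge_row b {i, j, k, h} e $ 2 * y3)
      + (edge_row b {i, j, k, l} e $ 1 * x4 + edge_row b {i, j, k, l} e $ 2 * y4) = 0"
    if "e \<subseteq> u" "card e = 2" for e
    using permitted_edge_equation[OF u c that]
    unfolding u_eq sum5 omit_pentachoron[OF ord] xy
    by (simp add: algebra_simps)
  note rows = edge_row_tetrahedron edge_row_outside vector_2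
  \<comment> \<open>the edge functionals, with the indices of \<open>x\<close> and \<open>y\<close> giving the position of the omitted vertex\<close>
  have ij: "(\<omega> j l h - \<omega> i l h) * x2 - (\<omega> j k h - \<omega> i k h) * x3 + (\<omega> j k l - \<omega> i k l) * x4 = 0"
    using eq[of "{i, j}"] ord trans neq by (simp add: u_eq rows \<omega>_def)
  have ik: "- ((\<omega> k l h - \<omega> i l h) * x1) - (\<omega> i j h * x3 + \<omega> j k h * y3) + (\<omega> i j l * x4 + \<omega> j k l * y4) = 0"
    using eq[of "{i, k}"] ord trans neq by (simp add: u_eq rows \<omega>_def)
  have il: "- (\<omega> i k h * x1) - \<omega> k l h * y1 + (\<omega> i j h * x2 + \<omega> j l h * y2)
      + (- (\<omega> i j k * x4) - \<omega> j k l * y4) = 0"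
    using eq[of "{i, l}"] ord trans neq by (simp add: u_eq rows \<omega>_def)
  have jk: "(\<omega> k l h - \<omega> j l h) * x0 - (- (\<omega> i j h * x3) - \<omega> i k h * y3)
      + (- (\<omega> i j l * x4) - \<omega> i k l * y4) = 0"
    using eq[of "{j, k}"] ord trans neq by (simp add: u_eq rows \<omega>_def)
  have jl: "\<omega> j k h * x0 + \<omega> k l h * y0 + (- (\<omega> i j h * x2) - \<omega> i l h * y2)
      + (\<omega> i j k * x4 + \<omega> i k l * y4) = 0"
    using eq[of "{j, l}"] ord trans neq by (simp add: u_eq rows \<omega>_def)
  have "(\<omega> j k l - \<omega> j k h) * y0 - (\<omega> i k l - \<omega> i k h) * y1 + (\<omega> i j l - \<omega> i j h) * y2 = 0"
    using eq[of "{l, h}"] ord trans neq by (simp add: u_eq rows \<omega>_def)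
  \<comment> \<open>the coefficients of the last edge, rewritten by the cocycle property of \<open>\<omega>\<close> to match \<open>potential\<close>\<close>
  then have lh: "(\<omega> k l h - \<omega> j l h) * y0 - (\<omega> k l h - \<omega> i l h) * y1 + (\<omega> j l h - \<omega> i l h) * y2 = 0"
    by (simp add: \<omega>_def omega_def algebra_simps)
  have ijkl: "\<omega> j k l - \<omega> i k l = \<omega> i j k - \<omega> i j l"
    by (simp add: \<omega>_def omega_def)
  \<comment> \<open>propagation through \<open>ijkl\<close>, \<open>ijkh\<close>, \<open>ijlh\<close>, \<open>iklh\<close>, starting from 0 on \<open>ijk\<close>\<close>
  define pijl where "pijl = (\<omega> j k l - \<omega> i k l) * x4"
  define pikl where "pikl = - (\<omega> i j l * x4 + \<omega> j k l * y4)"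
  define pjkl where "pjkl = pikl + (\<omega> j k l - \<omega> i k l) * y4"
  define pijh where "pijh = (\<omega> j k h - \<omega> i k h) * x3"
  define pikh where "pikh = - (\<omega> i j h * x3 + \<omega> j k h * y3)"
  define pjkh where "pjkh = pikh + (\<omega> j k h - \<omega> i k h) * y3"
  define pilh where "pilh = pijl - (\<omega> i j h * x2 + \<omega> j l h * y2)"
  define pjlh where "pjlh = pilh + (\<omega> j l h - \<omega> i l h) * y2"
  define pklh where "pklh = pilh + (\<omega> k l h - \<omega> i l h) * y1"
  \<comment> \<open>the value on \<open>klh\<close> also serves as the default outside the ten triangles\<close>
  define p where "p = (\<lambda>r s t.
    if (r, s, t) = (i, j, k) then 0 else if (r, s, t) = (i, j, l) then pijl
    else if (r, s, t) = (i, k, l) then pikl else if (r, s, t) = (j, k, l) then pjkl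
    else if (r, s, t) = (i, j, h) then pijh else if (r, s, t) = (i, k, h) then pikh
    else if (r, s, t) = (j, k, h) then pjkh else if (r, s, t) = (i, l, h) then pilh
    else if (r, s, t) = (j, l, h) then pjlh else pklh)"
  have p: "p i j k = 0" "p i j l = pijl" "p i k l = pikl" "p j k l = pjkl" "p i j h = pijh"
    "p i k h = pikh" "p j k h = pjkh" "p i l h = pilh" "p j l h = pjlh" "p k l h = pklh"
    using neq by (simp_all add: p_def)
  note p_defs = pijl_def pikl_def pjkl_def pijh_def pikh_def pjkh_def pilh_def pjlh_def pklh_def
  have "potential b {i, j, k, l} (c {i, j, k, l}) p"
    unfolding potential_def Let_def vert_tetrahedron[OF \<open>i < j\<close> \<open>j < k\<close> \<open>k < l\<close>] p
      \<omega>_def[symmetric] xy[symmetric]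
  proof (intro conjI)
    show "pijl - 0 = (\<omega> j k l - \<omega> i k l) * x4"
      by (simp add: p_defs)
    show "pjkl - pikl = (\<omega> j k l - \<omega> i k l) * y4"
      by (simp add: p_defs)
    show "0 - pikl = \<omega> i j l * x4 + \<omega> j k l * y4"
      by (simp add: p_defs)
  qed
  moreover have "potential b {i, j, k, h} (c {i, j, k, h}) p"
    unfolding potential_def Let_def vert_tetrahedron[OF \<open>i < j\<close> \<open>j < k\<close> \<open>k < h\<close>] p
      \<omega>_def[symmetric] xy[symmetric]
  proof (intro conjI)
    show "pijh - 0 = (\<omega> j k h - \<omega> i k h) * x3"
      by (simp add: p_defs)
    show "pjkh - pikh = (\<omega> j k h - \<omega> i k h) * y3"
      by (simp add: p_defs)
    show "0 - pikh = \<omega> i j h * x3 + \<omega> j k h * y3"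
      by (simp add: p_defs)
  qed
  moreover have "potential b {i, j, l, h} (c {i, j, l, h}) p"
    unfolding potential_def Let_def vert_tetrahedron[OF \<open>i < j\<close> \<open>j < l\<close> \<open>l < h\<close>] p
      \<omega>_def[symmetric] xy[symmetric]
  proof (intro conjI)
    show "pijh - pijl = (\<omega> j l h - \<omega> i l h) * x2"
      using ij unfolding p_defs by algebra
    show "pjlh - pilh = (\<omega> j l h - \<omega> i l h) * y2"
      by (simp add: p_defs)
    show "pijl - pilh = \<omega> i j h * x2 + \<omega> j l h * y2"
      by (simp add: p_defs)
  qed
  moreover have "potential b {i, k, l, h} (c {i, k, l, h}) p"
    unfolding potential_def Let_def vert_tetrahedron[OF \<open>i < k\<close> \<open>k < l\<close> \<open>l < h\<close>] p
      \<omega>_def[symmetric] xy[symmetric]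
  proof (intro conjI)
    show "pikh - pikl = (\<omega> k l h - \<omega> i l h) * x1"
      using ik unfolding p_defs by algebra
    show "pklh - pilh = (\<omega> k l h - \<omega> i l h) * y1"
      by (simp add: p_defs)
    show "pikl - pilh = \<omega> i k h * x1 + \<omega> k l h * y1"
      using il ijkl unfolding p_defs by algebra
  qed
  moreover have "potential b {j, k, l, h} (c {j, k, l, h}) p"
    unfolding potential_def Let_def vert_tetrahedron[OF \<open>j < k\<close> \<open>k < l\<close> \<open>l < h\<close>] p
      \<omega>_def[symmetric] xy[symmetric]
  proof (intro conjI)
    show "pjkh - pjkl = (\<omega> k l h - \<omega> j l h) * x0"
      using jk unfolding p_defs by algebra
    show "pklh - pjlh = (\<omega> k l h - \<omega> j l h) * y0"
      using lh unfolding p_defs by algebra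
    show "pjkl - pjlh = \<omega> j k h * x0 + \<omega> k l h * y0"
      using jl ijkl unfolding p_defs by algebra
  qed
  ultimately have pot: "potential b (omit u 0) (c (omit u 0)) p" "potential b (omit u 1) (c (omit u 1)) p"
    "potential b (omit u 2) (c (omit u 2)) p" "potential b (omit u 3) (c (omit u 3)) p"
    "potential b (omit u 4) (c (omit u 4)) p"
    unfolding u_eq omit_pentachoron[OF ord] by simp_all
  have "potential b (omit u m) (c (omit u m)) p" if "m < 5" for m
  proof -
    have "m = 0 \<or> m = 1 \<or> m = 2 \<or> m = 3 \<or> m = 4" using that by arith
    with pot show ?thesis by metis
  qed
  then show ?thesis
    by blast
qed

section \<open>The cocycle\<close>

text \<open>
  This is \<open>\<delta>\<delta> = 0\<close> for the function \<open>\<omega> p q\<close> on triangles, \<open>p\<close> and \<open>q\<close> being potentials of the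
  two colorings on the whole pentachoron.
\<close>

lemma z_cochain_cocycle:
  fixes b :: "'v::linorder \<Rightarrow> 'v \<Rightarrow> 'a::field"
  assumes u: "card u = 5" and f: "f \<in> permitted b u" and g: "g \<in> permitted b u"
  shows "(\<Sum>m<5. (- 1) ^ m * z_cochain b (omit u m) f g) = 0"
proof -
  obtain p where p: "\<And>m. m < 5 \<Longrightarrow> potential b (omit u m) (f (omit u m)) p"
    using permitted_potential[OF u f] by blast
  obtain q where q: "\<And>m. m < 5 \<Longrightarrow> potential b (omit u m) (g (omit u m)) q"
    using permitted_potential[OF u g] by blast
  obtain i j k l h where ord: "i < j" "j < k" "k < l" "l < h" and u_eq: "u = {i, j, k, l, h}"
    using pentachoron_cases[OF u] .
  then have trans: "i < k" "j < l" "k < h"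
    by auto
  define W where "W = (\<lambda>i j k. omega b i j k * p i j k * q i j k)"
  have "z_cochain b (omit u m) f g =
    W (vert (omit u m) 1) (vert (omit u m) 2) (vert (omit u m) 3)
    - W (vert (omit u m) 0) (vert (omit u m) 2) (vert (omit u m) 3)
    + W (vert (omit u m) 0) (vert (omit u m) 1) (vert (omit u m) 3)
    - W (vert (omit u m) 0) (vert (omit u m) 1) (vert (omit u m) 2)" if "m < 5" for m
    unfolding W_def using p[OF that] q[OF that] by (rule z_cochain_eq_boundary[of b _ f p g q])
  note z = this[of 0] this[of 1] this[of 2] this[of 3] this[of 4]
  have sum5: "(\<Sum>m<5. F m) = F 0 + F 1 + F 2 + F 3 + F (4::nat)" for F :: "nat \<Rightarrow> 'a"
    by (simp add: eval_nat_numeral add.assoc)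
  show ?thesis
    using z unfolding sum5 u_eq omit_pentachoron[OF ord]
      vert_tetrahedron[OF ord(1,2,3)] vert_tetrahedron[OF ord(2,3,4)]
      vert_tetrahedron[OF trans(1) ord(3,4)] vert_tetrahedron[OF ord(1) trans(2) ord(4)]
      vert_tetrahedron[OF ord(1,2) trans(3)]
    by simp
qed

lemma coboundary_z_cochain:
  assumes "card u = 5"
  shows "coboundary (z_cochain b) u f g = (\<Sum>m<5. (- 1) ^ m * z_cochain b (omit u m) f g)"
proof -
  have "card (omit u m) = 4" "finite (omit u m)" if "m < 5" for m
    using bij_betw_omit[of u 3] assms that
    by (auto simp: bij_betw_def faces_def card_ge_0_finite dest!: equalityD1)
  then have "faces 3 (omit u m) = {omit u m}" if "m < 5" for m
    using that by (simp add: faces_self)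
  then show ?thesis
    unfolding coboundary_def assms by (intro sum.cong) (simp_all add: z_cochain_def restr_def)
qed

lemma sum_eps_z_cochain:
  assumes "card u = 5"
  shows "(\<Sum>t\<in>faces 3 u. eps u t * z_cochain b t (restr f t) (restr g t)) =
    (\<Sum>m<5. (- 1) ^ m * z_cochain b (omit u m) f g)"
proof -
  have "(\<Sum>t\<in>faces 3 u. eps u t * z_cochain b t (restr f t) (restr g t)) =
      (\<Sum>m<card u. (- 1) ^ m * z_cochain b (omit u m) (restr f (omit u m)) (restr g (omit u m)))"
    using assms by (intro sum_eps_faces) simp
  then show ?thesis
    using coboundary_z_cochain[OF assms] by (simp add: coboundary_def)
qed

lemma sym_bilinear_z_cochain: "sym_bilinear_on V (z_cochain b t)"
  by (simp add: sym_bilinear_on_def z_cochain_def Let_def algebra_simps)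

section \<open>Genericity and nontriviality\<close>

text \<open>
  With a summation range that two polynomials can share, evaluation is visibly additive.
\<close>

lemma mpoly_eval_superset:
  assumes "finite M" "Poly_Mapping.keys P \<subseteq> M"
  shows "mpoly_eval \<beta> P = (\<Sum>m\<in>M. Poly_Mapping.lookup P m *
        (\<Prod>x\<in>Poly_Mapping.keys m. \<beta> x ^ Poly_Mapping.lookup m x))"
  unfolding mpoly_eval_def
  by (rule sum.mono_neutral_left) (use assms in \<open>auto simp: in_keys_iff\<close>)

lemma mpoly_eval_add: "mpoly_eval \<beta> (P + Q) = mpoly_eval \<beta> P + mpoly_eval \<beta> Q"
proof -
  let ?M = "Poly_Mapping.keys P \<union> Poly_Mapping.keys Q"
  have fin: "finite ?M" by simp
  show ?thesis
    using mpoly_eval_superset[OF fin Poly_Mapping.keys_add] mpoly_eval_superset[OF fin Un_upper1]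
      mpoly_eval_superset[OF fin Un_upper2]
    by (simp add: lookup_add distrib_right sum.distrib)
qed

definition edge_var :: "'a \<Rightarrow> nat \<times> nat \<Rightarrow> (nat \<times> nat, 'a::field) mpoly" where
  "edge_var a e = Poly_Mapping.single (Poly_Mapping.single e 1) a"

lemma mpoly_eval_edge_var: "mpoly_eval \<beta> (edge_var a e) = a * \<beta> e"
  by (simp add: mpoly_eval_def edge_var_def)

lemma edge_poly_edge_var: "i < j \<Longrightarrow> j \<le> n \<Longrightarrow> edge_poly n (edge_var a (i, j))"
  by (simp add: edge_poly_def edge_var_def)

lemma edge_poly_add: "edge_poly n P \<Longrightarrow> edge_poly n Q \<Longrightarrow> edge_poly n (P + Q)"
  using Poly_Mapping.keys_add[of P Q] by (fastforce simp: edge_poly_def)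

lemma lookup_edge_var:
  "Poly_Mapping.lookup (edge_var a e) (Poly_Mapping.single e' 1) = (if e = e' then a else 0)"
  by (auto simp: edge_var_def lookup_single when_def dest: arg_cong[where f = Poly_Mapping.keys])

text \<open>The form \<open>\<omega>\<^sub>0\<^sub>1\<^sub>2\<close>.\<close>

definition triangle_poly :: "(nat \<times> nat, 'a::field) mpoly" where
  "triangle_poly = edge_var 1 (0, 1) + edge_var (- 1) (0, 2) + edge_var 1 (1, 2)"

text \<open>The form \<open>\<omega>\<^sub>1\<^sub>2\<^sub>3 - \<omega>\<^sub>0\<^sub>2\<^sub>3\<close>, in which \<open>b\<^sub>2\<^sub>3\<close> cancels.\<close>

definition tetrahedron_poly :: "(nat \<times> nat, 'a::field) mpoly" where
  "tetrahedron_poly =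
     edge_var 1 (1, 2) + edge_var (- 1) (1, 3) + edge_var (- 1) (0, 2) + edge_var 1 (0, 3)"

definition generic_poly :: "nat \<Rightarrow> (nat \<times> nat, 'a::field) mpoly" where
  "generic_poly n = (if n = 2 then triangle_poly else if n = 3 then tetrahedron_poly else 1)"

lemma edge_poly_generic_poly: "edge_poly n (generic_poly n)"
  by (auto simp: generic_poly_def triangle_poly_def tetrahedron_poly_def
      intro!: edge_poly_add edge_poly_edge_var) (simp add: edge_poly_def)

text \<open>
  Evaluation at a point could not show this over a finite field, so a coefficient is read off:
  that of the variable \<open>(1, 2)\<close>, which occurs with coefficient 1 in both forms.
\<close>

lemma generic_poly_nonzero: "(generic_poly n :: (nat \<times> nat, 'a::field) mpoly) \<noteq> 0"
proof -
  have "Poly_Mapping.lookup (triangle_poly :: (nat \<times> nat, 'a) mpoly)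
      (Poly_Mapping.single (1, 2) 1) = 1"
    "Poly_Mapping.lookup (tetrahedron_poly :: (nat \<times> nat, 'a) mpoly)
      (Poly_Mapping.single (1, 2) 1) = 1"
    unfolding triangle_poly_def tetrahedron_poly_def lookup_add lookup_edge_var by simp_all
  then show ?thesis
    by (auto simp: generic_poly_def)
qed

lemma generic_omega_nonzero:
  assumes "generic generic_poly K b" "{i, j, k} \<in> K" "i < j" "j < k"
  shows "omega b i j k \<noteq> 0"
proof -
  have "{i, j, k} \<in> simplices K 2"
    using assms by (auto simp: simplices_def card_insert_if)
  with assms(1) have "mpoly_eval (\<lambda>(x, y). b (vert {i, j, k} x) (vert {i, j, k} y)) triangle_poly \<noteq> 0"
    unfolding generic_def by (force simp: generic_poly_def)
  then show ?thesis
    unfolding triangle_poly_def mpoly_eval_add mpoly_eval_edge_var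
    by (simp add: vert_triangle[OF assms(3,4), unfolded One_nat_def] omega_def)
qed

lemma generic_omega_difference_nonzero:
  assumes "generic generic_poly K b" "{i, j, k, l} \<in> K" "i < j" "j < k" "k < l"
  shows "omega b j k l - omega b i k l \<noteq> 0"
proof -
  have "{i, j, k, l} \<in> simplices K 3"
    using assms by (auto simp: simplices_def card_insert_if)
  with assms(1) have
    "mpoly_eval (\<lambda>(x, y). b (vert {i, j, k, l} x) (vert {i, j, k, l} y)) tetrahedron_poly \<noteq> 0"
    unfolding generic_def by (force simp: generic_poly_def)
  moreover have "mpoly_eval (\<lambda>(x, y). b (vert {i, j, k, l} x) (vert {i, j, k, l} y)) tetrahedron_poly
      = b j k - b j l - b i k + b i l"
    unfolding tetrahedron_poly_def mpoly_eval_add mpoly_eval_edge_var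
    by (simp add: vert_tetrahedron[OF assms(3-5), unfolded One_nat_def])
  moreover have "omega b j k l - omega b i k l = b j k - b j l - b i k + b i l"
    by (simp add: omega_def)
  ultimately show ?thesis
    by (simp only: not_False_eq_True)
qed

text \<open>
  There are no nonzero 2-cochains, so it suffices that the form \<open>z\<^sub>t\<close> does not vanish at the color
  \<open>(1, 0)\<close> of one tetrahedron, which is permitted because a tetrahedron has no 4-faces.
\<close>

lemma z_cochain_not_coboundary:
  fixes b :: "'v::linorder \<Rightarrow> 'v \<Rightarrow> 'a::field"
  assumes K: "ordered_complex K" and gen: "generic generic_poly K b" and t: "t \<in> simplices K 3"
  shows "\<not> is_coboundary K b 3 (z_cochain b)"
proof
  assume "is_coboundary K b 3 (z_cochain b)"
  then have zero: "z_cochain b t f f = 0" if "f \<in> permitted b t" for f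
    using t that by (auto simp: is_coboundary_def is_cochain_def cochain_eq_def coboundary_def)
  have "card t = 4" using t by (simp add: simplices_def)
  then obtain i j k l where ord: "i < j" "j < k" "k < l" and t_eq: "t = {i, j, k, l}"
    by (rule tetrahedron_cases)
  define f :: "('v, 'a) coloring" where "f = (\<lambda>s. if s = t then vector [1, 0] else 0)"
  have "faces 4 t = {}"
  proof (rule equals0I)
    fix s assume "s \<in> faces 4 t"
    then have "s \<subseteq> t" "card s = 5" by (simp_all add: faces_def)
    with card_mono[of t s] show False using \<open>card t = 4\<close> by (simp add: t_eq)
  qed
  then have "f \<in> permitted b t"
    using \<open>card t = 4\<close> by (auto simp: permitted_def colorings_def f_def faces_def)
  then have "z_cochain b t f f = 0" by (rule zero)
  then have "(omega b j k l - omega b i k l) * (omega b i j k * omega b i j l) = 0"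
    by (simp add: z_cochain_def f_def vert_tetrahedron[OF ord, unfolded One_nat_def] t_eq Let_def)
  moreover have "{i, j, k, l} \<in> K" using t t_eq by (simp add: simplices_def)
  moreover have "s \<in> K" if "s \<subseteq> t" "s \<noteq> {}" for s
    using K t that unfolding ordered_complex_def simplices_def by blast
  then have "{i, j, k} \<in> K" "{i, j, l} \<in> K"
    by (simp_all add: t_eq)
  ultimately show False
    using generic_omega_nonzero[OF gen, of i j k] generic_omega_nonzero[OF gen, of i j l]
      generic_omega_difference_nonzero[OF gen, of i j k l] ord by simp
qed

theorem theorem3:
  shows "\<exists>P :: nat \<Rightarrow> (nat \<times> nat, 'a::field) mpoly.
    (\<forall>n. edge_poly n (P n) \<and> P n \<noteq> 0) \<and>
    (\<forall>(K :: 'v::linorder set set) (b :: 'v \<Rightarrow> 'v \<Rightarrow> 'a).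
       ordered_complex K \<and> simplices K 3 \<noteq> {} \<and> generic P K b \<longrightarrow>
         is_cocycle K b 3 (z_cochain b) \<and>
         \<not> is_coboundary K b 3 (z_cochain b) \<and>
         (\<forall>u\<in>simplices K 4. \<forall>f\<in>permitted b u. \<forall>g\<in>permitted b u.
            (\<Sum>t\<in>faces 3 u. eps u t * z_cochain b t (restr f t) (restr g t)) = 0))"
proof (intro exI[of _ generic_poly] conjI allI impI ballI; (elim conjE)?)
  fix n
  show "edge_poly n (generic_poly n)" "generic_poly n \<noteq> 0"
    by (rule edge_poly_generic_poly generic_poly_nonzero)+
next
  fix K :: "'v set set" and b :: "'v \<Rightarrow> 'v \<Rightarrow> 'a"
  assume K: "ordered_complex K" "simplices K 3 \<noteq> {}" and gen: "generic generic_poly K b"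
  show "is_cocycle K b 3 (z_cochain b)"
    by (auto simp: is_cocycle_def is_cochain_def cochain_eq_def sym_bilinear_z_cochain
        simplices_def coboundary_z_cochain z_cochain_cocycle)
  show "\<not> is_coboundary K b 3 (z_cochain b)"
    using z_cochain_not_coboundary[OF K(1) gen] K(2) by blast
  fix u f g
  assume "u \<in> simplices K 4" "f \<in> permitted b u" "g \<in> permitted b u"
  then show "(\<Sum>t\<in>faces 3 u. eps u t * z_cochain b t (restr f t) (restr g t)) = 0"
    by (simp add: sum_eps_z_cochain simplices_def z_cochain_cocycle)
qed

end
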